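(* Let $A$ be a uniform algebra on a compact Hausdorff space $K$ and let $t_0$ be an isolated point of the Shilov boundary $\Gamma$ of $A$. Then there exists a projection $P: A\to A$ such that $\|P\|=\|I-P\|=1$.
   Context: $C(K)$ is the space of complex-valued continuous functions on $K$ with the supremum norm $\|\cdot\|_\infty$. A uniform algebra on $K$ is a closed subalgebra of $C(K)$ that separates the points of $K$ and contains the constant functions. A subset $L\subset K$ is a boundary for $A$ if for every $f\in A$ there is $t\in L$ with $|f(t)|=\|f\|_\infty$; the Shilov boundary $\Gamma$ of $A$ is the smallest closed boundary for $A$. Isolated means isolated in the relative topology of $\Gamma$. A projection is a bounded linear operator $P$ with $P^2=P$, $I$ is the identity operator on $A$, and the norms of $P$ and $I-P$ are operator norms.
   Formalization: The compact Hausdorff space K is assumed to have at least two points; for a one-point K the algebra A is just the constants, its only projections are 0 and I, and the claim fails. *)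

theory Defs
  imports "HOL-Analysis.Analysis"
begin

(* K is rendered as a type 'k :: t2_space whose universe is compact (an assumption of the
   theorem), so every continuous function on K is bounded and C(K) is the library type
   'k \<Rightarrow>\<^sub>C complex, whose norm is the supremum norm. The library gives it neither a
   multiplication nor a complex scalar action; scaling by c is multiplication by the
   constant function c. A one-point K has to be excluded: there A consists of the constants
   and 0 and I are the only projections. *)

definition bc_mult ::
  "('k::topological_space \<Rightarrow>\<^sub>C complex) \<Rightarrow> ('k \<Rightarrow>\<^sub>C complex) \<Rightarrow> ('k \<Rightarrow>\<^sub>C complex)" where
  "bc_mult f g = Bcontfun (\<lambda>x. apply_bcontfun f x * apply_bcontfun g x)"

lemma apply_bc_mult [simp]:
  "apply_bcontfun (bc_mult f g) x = apply_bcontfun f x * apply_bcontfun g x"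
proof -
  obtain a where a: "\<And>x. norm (apply_bcontfun f x) \<le> a"
    using bounded_apply_bcontfun[of f] unfolding bounded_iff by auto
  obtain b where b: "\<And>x. norm (apply_bcontfun g x) \<le> b"
    using bounded_apply_bcontfun[of g] unfolding bounded_iff by auto
  have "norm (apply_bcontfun f x * apply_bcontfun g x) \<le> a * b" for x
    unfolding norm_mult by (rule mult_mono'[OF a b]) auto
  then have "bounded (range (\<lambda>x. apply_bcontfun f x * apply_bcontfun g x))"
    unfolding bounded_iff by auto
  then have "(\<lambda>x. apply_bcontfun f x * apply_bcontfun g x) \<in> bcontfun"
    by (auto simp: bcontfun_def intro!: continuous_intros)
  then show ?thesis
    by (simp add: bc_mult_def Bcontfun_inverse)
qed

definition bc_scale ::
  "complex \<Rightarrow> ('k::topological_space \<Rightarrow>\<^sub>C complex) \<Rightarrow> ('k \<Rightarrow>\<^sub>C complex)" where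
  "bc_scale c f = bc_mult (const_bcontfun c) f"

definition uniform_algebra :: "('k::topological_space \<Rightarrow>\<^sub>C complex) set \<Rightarrow> bool" where
  "uniform_algebra A \<longleftrightarrow>
     closed A \<and>
     (\<forall>f\<in>A. \<forall>g\<in>A. f + g \<in> A) \<and>
     (\<forall>c. \<forall>f\<in>A. bc_scale c f \<in> A) \<and>
     (\<forall>f\<in>A. \<forall>g\<in>A. bc_mult f g \<in> A) \<and>
     (\<forall>s t. s \<noteq> t \<longrightarrow> (\<exists>f\<in>A. apply_bcontfun f s \<noteq> apply_bcontfun f t)) \<and>
     (\<forall>c. const_bcontfun c \<in> A)"

definition is_boundary ::
  "('k::topological_space \<Rightarrow>\<^sub>C complex) set \<Rightarrow> 'k set \<Rightarrow> bool" where
  "is_boundary A L \<longleftrightarrow> (\<forall>f\<in>A. \<exists>t\<in>L. cmod (apply_bcontfun f t) = norm f)"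

(* LEAST is taken with respect to inclusion of sets. *)
definition shilov_boundary ::
  "('k::topological_space \<Rightarrow>\<^sub>C complex) set \<Rightarrow> 'k set" where
  "shilov_boundary A = (LEAST L. closed L \<and> is_boundary A L)"

(* Operators on A are functions on all of C(K) of which only the values on A matter. *)
definition bounded_operator_on ::
  "('k::topological_space \<Rightarrow>\<^sub>C complex) set \<Rightarrow>
   (('k \<Rightarrow>\<^sub>C complex) \<Rightarrow> ('k \<Rightarrow>\<^sub>C complex)) \<Rightarrow> bool" where
  "bounded_operator_on A T \<longleftrightarrow>
     (\<forall>f\<in>A. T f \<in> A) \<and>
     (\<forall>f\<in>A. \<forall>g\<in>A. T (f + g) = T f + T g) \<and>
     (\<forall>c. \<forall>f\<in>A. T (bc_scale c f) = bc_scale c (T f)) \<and>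
     (\<exists>M. \<forall>f\<in>A. norm (T f) \<le> M * norm f)"

(* The library's onorm, relativised to A; as there, f = 0 contributes 0 to the supremum. *)
definition onorm_on ::
  "('k::topological_space \<Rightarrow>\<^sub>C complex) set \<Rightarrow>
   (('k \<Rightarrow>\<^sub>C complex) \<Rightarrow> ('k \<Rightarrow>\<^sub>C complex)) \<Rightarrow> real" where
  "onorm_on A T = (SUP f\<in>A. norm (T f) / norm f)"

definition projection_on ::
  "('k::topological_space \<Rightarrow>\<^sub>C complex) set \<Rightarrow>
   (('k \<Rightarrow>\<^sub>C complex) \<Rightarrow> ('k \<Rightarrow>\<^sub>C complex)) \<Rightarrow> bool" where
  "projection_on A P \<longleftrightarrow> bounded_operator_on A P \<and> (\<forall>f\<in>A. P (P f) = P f)"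

end

theory Submission
  imports Defs
begin

text \<open>
  The Shilov boundary consists of the points \<open>x\<close> such that every neighbourhood of \<open>x\<close> contains the
  whole set where \<open>\<bar>f\<bar>\<close> is maximal, for some \<open>f \<in> A\<close>. An isolated point \<open>t0\<close> of it therefore admits
  \<open>f \<in> A\<close> with \<open>f t0 = 1 = \<parallel>f\<parallel>\<close> and \<open>\<bar>f\<bar> \<le> r < 1\<close> on the rest of the boundary. The powers of \<open>f\<close>
  converge uniformly on the boundary, hence in \<open>A\<close>, to a function \<open>h\<close> that restricts to the
  indicator of \<open>t0\<close>, and \<open>P g = g(t0) h\<close> is the required projection.
\<close>

section \<open>Powers, scalings and operator norms of bounded continuous functions\<close>

definition bc_power ::
  "('k::topological_space \<Rightarrow>\<^sub>C complex) \<Rightarrow> nat \<Rightarrow> ('k \<Rightarrow>\<^sub>C complex)" where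
  "bc_power f n = (bc_mult f ^^ n) (const_bcontfun 1)"

lemma apply_bc_power [simp]: "apply_bcontfun (bc_power f n) x = apply_bcontfun f x ^ n"
  by (induction n) (simp_all add: bc_power_def const_bcontfun.rep_eq)

lemma apply_bc_scale [simp]: "apply_bcontfun (bc_scale c f) x = c * apply_bcontfun f x"
  by (simp add: bc_scale_def const_bcontfun.rep_eq)

lemma norm_bc_scale: "norm (bc_scale c f) = cmod c * norm f"
proof -
  have le: "norm (bc_scale c f) \<le> cmod c * norm f" for c and f :: "'a \<Rightarrow>\<^sub>C complex"
    by (rule norm_bound) (simp add: norm_mult mult_left_mono norm_bounded)
  have "cmod c * norm f \<le> norm (bc_scale c f)" if "c \<noteq> 0"
  proof -
    have "f = bc_scale (inverse c) (bc_scale c f)"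
      using that by (intro bcontfun_eqI) simp
    then have "norm f \<le> cmod (inverse c) * norm (bc_scale c f)"
      using le by metis
    then show ?thesis
      using that by (simp add: norm_inverse norm_divide field_simps)
  qed
  then show ?thesis
    using le[of c f] by (cases "c = 0") auto
qed

text \<open>The estimate bounds every quotient by 1, and a nonzero fixed vector attains this bound.
  At the zero function the quotient is 0 by the convention for division.\<close>

lemma onorm_on_eq_1:
  assumes le: "\<And>f. f \<in> A \<Longrightarrow> norm (T f) \<le> norm f"
    and f: "f \<in> A" "f \<noteq> 0" "T f = f"
  shows "onorm_on A T = 1"
proof -
  have "norm (T g) / norm g \<le> 1" if "g \<in> A" for g
    using le[OF that] by (simp add: divide_le_eq_1)
  then show ?thesis
    unfolding onorm_on_def using f
    by (intro cSup_eq_maximum) (auto intro!: image_eqI[where x = f])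
qed

text \<open>
  The library proves completeness of the space of bounded continuous functions only when the
  domain is a metric space.
\<close>
lemma Cauchy_bcontfun_convergent:
  fixes f :: "nat \<Rightarrow> 'a::topological_space \<Rightarrow>\<^sub>C 'b::complete_space"
  assumes "Cauchy f"
  obtains l where "f \<longlonglongrightarrow> l"
proof -
  have "uniformly_Cauchy_on UNIV (\<lambda>n. apply_bcontfun (f n))"
    using assms unfolding Cauchy_def uniformly_Cauchy_on_def
    by (meson dist_fun_lt_imp_dist_val_lt)
  then obtain g where "uniform_limit UNIV (\<lambda>n. apply_bcontfun (f n)) g sequentially"
    using Cauchy_uniformly_convergent unfolding uniformly_convergent_on_def by blast
  then show ?thesis
    by (rule uniform_limit_bcontfunE[OF _ sequentially_bot]) (rule that)
qed

section \<open>Uniform algebras on a compact Hausdorff space\<close>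

locale compact_uniform_algebra =
  fixes A :: "('k::t2_space \<Rightarrow>\<^sub>C complex) set"
  assumes compact_space: "compact (UNIV :: 'k set)"
    and uniform_algebra: "uniform_algebra A"
begin

lemma
  shows closed_A: "closed A"
    and add_mem: "\<lbrakk>f \<in> A; g \<in> A\<rbrakk> \<Longrightarrow> f + g \<in> A"
    and scale_mem: "f \<in> A \<Longrightarrow> bc_scale c f \<in> A"
    and mult_mem: "\<lbrakk>f \<in> A; g \<in> A\<rbrakk> \<Longrightarrow> bc_mult f g \<in> A"
    and separates: "s \<noteq> t \<Longrightarrow> \<exists>f\<in>A. apply_bcontfun f s \<noteq> apply_bcontfun f t"
    and const_mem: "const_bcontfun c \<in> A"
  using uniform_algebra unfolding uniform_algebra_def by auto

lemma diff_mem: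
  assumes "f \<in> A" "g \<in> A"
  shows "f - g \<in> A"
proof -
  have "f - g = f + bc_scale (-1) g"
    by (rule bcontfun_eqI) (simp add: plus_bcontfun.rep_eq minus_bcontfun.rep_eq)
  then show ?thesis
    using assms by (simp only: add_mem scale_mem)
qed

lemma power_mem: "f \<in> A \<Longrightarrow> bc_power f n \<in> A"
  by (induction n) (auto simp: bc_power_def const_mem mult_mem)

lemma compact_closed: "closed (C :: 'k set) \<Longrightarrow> compact C"
  using compact_Int_closed[OF compact_space] by simp

lemma is_boundary_UNIV: "is_boundary A UNIV"
  unfolding is_boundary_def
proof
  fix f assume "f \<in> A"
  have "continuous_on UNIV (\<lambda>x. cmod (apply_bcontfun f x))"
    by (intro continuous_intros continuous_on_apply_bcontfun)
  then obtain x where "\<And>y. cmod (apply_bcontfun f y) \<le> cmod (apply_bcontfun f x)"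
    using continuous_attains_sup[OF compact_space] by auto
  then have "norm f \<le> cmod (apply_bcontfun f x)"
    by (rule norm_bound)
  then show "\<exists>t\<in>UNIV. cmod (apply_bcontfun f t) = norm f"
    using norm_bounded[of f x] by (auto intro: antisym)
qed

text \<open>By compactness the modulus attains its maximum on \<open>C\<close>, and \<open>r\<close>
  is the ratio of this maximum to the norm. The multiplicative form allows n-th powers to be
  compared with \<open>norm f ^ n\<close>.\<close>

lemma bounded_away_from_norm:
  fixes C :: "'k set"
  assumes "closed C" and lt: "\<And>x. x \<in> C \<Longrightarrow> cmod (apply_bcontfun f x) \<noteq> norm f"
  obtains r where "0 \<le> r" "r < 1" "\<And>x. x \<in> C \<Longrightarrow> cmod (apply_bcontfun f x) \<le> r * norm f"
proof (cases "C = {}")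
  case True
  then show ?thesis
    using that[of 0] by simp
next
  case False
  have "continuous_on C (\<lambda>x. cmod (apply_bcontfun f x))"
    by (intro continuous_intros continuous_on_apply_bcontfun)
  then obtain x where x: "x \<in> C" "\<And>y. y \<in> C \<Longrightarrow> cmod (apply_bcontfun f y) \<le> cmod (apply_bcontfun f x)"
    using continuous_attains_sup[OF compact_closed[OF \<open>closed C\<close>] False] by metis
  have less: "cmod (apply_bcontfun f x) < norm f"
    using lt[OF x(1)] norm_bounded[of f x] by simp
  then have "0 < norm f"
    using norm_ge_zero[of "apply_bcontfun f x"] by linarith
  with less x(2) show ?thesis
    by (intro that[of "cmod (apply_bcontfun f x) / norm f"]) auto
qed

section \<open>Peaking functions and polyhedral neighbourhoods\<close>

definition peaks_within :: "'k set \<Rightarrow> bool" where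
  "peaks_within U \<longleftrightarrow> (\<exists>f\<in>A. \<forall>x. cmod (apply_bcontfun f x) = norm f \<longrightarrow> x \<in> U)"

lemma peaks_within_mono: "\<lbrakk>peaks_within U; U \<subseteq> V\<rbrakk> \<Longrightarrow> peaks_within V"
  unfolding peaks_within_def by blast

definition polyball :: "('k \<Rightarrow>\<^sub>C complex) set \<Rightarrow> 'k set" where
  "polyball F = {x. \<forall>f\<in>F. cmod (apply_bcontfun f x) < 1}"

lemma open_polyball:
  assumes "finite F"
  shows "open (polyball F)"
proof -
  have "polyball F = (\<Inter>f\<in>F. {x. cmod (apply_bcontfun f x) < 1})"
    by (auto simp: polyball_def)
  moreover have "open {x. cmod (apply_bcontfun f x) < 1}" for f :: "'k \<Rightarrow>\<^sub>C complex"
    by (intro open_Collect_less continuous_intros continuous_on_apply_bcontfun)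
  ultimately show ?thesis
    using assms by auto
qed

text \<open>On a compact space the weak topology of a separating algebra is the given one: finitely
  many of the sets where some \<open>f y\<close>, vanishing at \<open>x\<close>, exceeds 1 in
  modulus cover the complement of \<open>U\<close>.\<close>

lemma polyball_neighbourhood:
  assumes "open U" "x \<in> U"
  obtains F where "finite F" "F \<subseteq> A" "x \<in> polyball F" "polyball F \<subseteq> U"
proof -
  have "\<exists>f\<in>A. apply_bcontfun f x = 0 \<and> 1 < cmod (apply_bcontfun f y)" if "y \<in> - U" for y
  proof -
    from that \<open>x \<in> U\<close> have "x \<noteq> y"
      by auto
    then obtain g where g: "g \<in> A" "apply_bcontfun g x \<noteq> apply_bcontfun g y"
      using separates by blast
    \<comment> \<open>This factor gives the shifted \<open>g\<close> the value 2 at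
      \<open>y\<close>; any value of modulus above 1 would serve.\<close>
    define c where "c = 2 / (apply_bcontfun g y - apply_bcontfun g x)"
    have c: "c * (apply_bcontfun g y - apply_bcontfun g x) = 2"
      unfolding c_def using g(2) by (intro nonzero_eq_divide_eq[THEN iffD1]) auto
    define f where "f = bc_scale c (g - const_bcontfun (apply_bcontfun g x))"
    have "apply_bcontfun f z = c * (apply_bcontfun g z - apply_bcontfun g x)" for z
      by (simp add: f_def minus_bcontfun.rep_eq const_bcontfun.rep_eq)
    then have "apply_bcontfun f y = 2" "apply_bcontfun f x = 0"
      by (simp_all only: c diff_self mult_zero_right)
    moreover have "f \<in> A"
      using g by (auto simp: f_def intro!: scale_mem diff_mem const_mem)
    ultimately show ?thesis
      by force
  qed
  then obtain f where f: "\<And>y. y \<in> - U \<Longrightarrow> f y \<in> A" "\<And>y. y \<in> - U \<Longrightarrow> apply_bcontfun (f y) x = 0"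
      "\<And>y. y \<in> - U \<Longrightarrow> 1 < cmod (apply_bcontfun (f y) y)"
    by metis
  have "compact (- U)"
    using assms by (intro compact_closed) auto
  moreover have "open {z. 1 < cmod (apply_bcontfun (f y) z)}" for y
    by (intro open_Collect_less continuous_intros continuous_on_apply_bcontfun)
  moreover have "- U \<subseteq> (\<Union>y\<in>- U. {z. 1 < cmod (apply_bcontfun (f y) z)})"
    using f(3) by blast
  ultimately obtain Y where Y: "Y \<subseteq> - U" "finite Y"
      "- U \<subseteq> (\<Union>y\<in>Y. {z. 1 < cmod (apply_bcontfun (f y) z)})"
    by (rule compactE_image)
  show ?thesis
  proof
    show "finite (f ` Y)" "f ` Y \<subseteq> A" "x \<in> polyball (f ` Y)"
      using Y f by (auto simp: polyball_def subset_iff)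
    show "polyball (f ` Y) \<subseteq> U"
    proof
      fix z assume z: "z \<in> polyball (f ` Y)"
      show "z \<in> U"
      proof (rule ccontr)
        assume "z \<notin> U"
        then obtain y where "y \<in> Y" "1 < cmod (apply_bcontfun (f y) z)"
          using Y(3) by blast
        with z show False
          by (auto simp: polyball_def)
      qed
    qed
  qed
qed

text \<open>
  If \<open>f\<close> does not attain its norm on \<open>E - polyball F\<close>,
  then for large \<open>n\<close> the products \<open>f\<^sup>n g\<close>, \<open>g \<in> F\<close>, are
  smaller than \<open>\<parallel>f\<parallel>\<^sup>n\<close> on \<open>E\<close>, hence everywhere, so that \<open>\<bar>g\<bar> < 1\<close> wherever \<open>\<bar>f\<bar> = \<parallel>f\<parallel>\<close>.
\<close>
lemma is_boundary_diff_polyball: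
  assumes "closed E" "is_boundary A E" "finite F" "F \<subseteq> A" "\<not> peaks_within (polyball F)"
  shows "is_boundary A (E - polyball F)"
proof (rule ccontr)
  assume "\<not> is_boundary A (E - polyball F)"
  then obtain f where f: "f \<in> A" "\<And>t. t \<in> E - polyball F \<Longrightarrow> cmod (apply_bcontfun f t) \<noteq> norm f"
    unfolding is_boundary_def by blast
  have attained: "\<exists>t\<in>E. cmod (apply_bcontfun g t) = norm g" if "g \<in> A" for g
    using assms(2) that unfolding is_boundary_def by blast
  have "x \<in> polyball F" if x: "cmod (apply_bcontfun f x) = norm f" for x
    unfolding polyball_def
  proof safe
    fix g assume "g \<in> F"
    then have "g \<in> A"
      using assms by blast
    show "cmod (apply_bcontfun g x) < 1"
    proof (cases "f = 0")
      case True
      \<comment> \<open>The zero function attains its norm everywhere, so no point of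
        \<open>E\<close> can lie outside the polyball.\<close>
      then have "E \<subseteq> polyball F"
        using f(2) by auto
      then have "norm g < 1"
        using attained[OF \<open>g \<in> A\<close>] \<open>g \<in> F\<close> by (force simp: polyball_def)
      then show ?thesis
        using norm_bounded[of g x] by linarith
    next
      case False
      then have pos: "0 < norm f ^ n" for n
        by simp
      have "closed (E - polyball F)"
        using assms open_polyball by blast
      from this f(2) obtain r where r: "0 \<le> r" "r < 1"
          "\<And>t. t \<in> E - polyball F \<Longrightarrow> cmod (apply_bcontfun f t) \<le> r * norm f"
        by (rule bounded_away_from_norm) auto
      have "(\<lambda>n. r ^ n * norm g) \<longlonglongrightarrow> 0"
        using r by (intro tendsto_mult_left_zero LIMSEQ_power_zero) auto
      then have "\<forall>\<^sub>F n in sequentially. r ^ n * norm g < 1"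
        by (rule order_tendstoD) auto
      then obtain n where n: "r ^ n * norm g < 1"
        by (auto simp: eventually_sequentially)
      define p where "p = bc_mult (bc_power f n) g"
      have "p \<in> A"
        using f \<open>g \<in> A\<close> by (simp add: p_def mult_mem power_mem)
      then obtain t where t: "t \<in> E" "cmod (apply_bcontfun p t) = norm p"
        using attained by blast
      have norm_p: "norm p = cmod (apply_bcontfun f t) ^ n * cmod (apply_bcontfun g t)"
        using t(2) by (simp add: p_def norm_mult norm_power)
      \<comment> \<open>At the point \<open>t\<close> where \<open>p\<close> attains its norm, the
        strict gain comes from the factor \<open>g\<close> inside the polyball and from
        \<open>r ^ n * norm g < 1\<close> outside it.\<close>
      have "norm p < norm f ^ n"
      proof (cases "t \<in> polyball F")
        case True
        have "norm p \<le> norm f ^ n * cmod (apply_bcontfun g t)"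
          unfolding norm_p by (intro mult_right_mono power_mono norm_bounded) auto
        also have "\<dots> < norm f ^ n * 1"
          using True \<open>g \<in> F\<close> pos by (intro mult_strict_left_mono) (auto simp: polyball_def)
        finally show ?thesis
          by simp
      next
        case False
        have "norm p \<le> (r * norm f) ^ n * norm g"
          unfolding norm_p using r t False
          by (intro mult_mono power_mono norm_bounded) auto
        also have "\<dots> = norm f ^ n * (r ^ n * norm g)"
          by (simp add: power_mult_distrib)
        also have "\<dots> < norm f ^ n * 1"
          using n pos by (intro mult_strict_left_mono) auto
        finally show ?thesis
          by simp
      qed
      moreover have "norm f ^ n * cmod (apply_bcontfun g x) \<le> norm p"
        using norm_bounded[of p x] x by (simp add: p_def norm_mult norm_power)
      ultimately have "norm f ^ n * cmod (apply_bcontfun g x) < norm f ^ n * 1"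
        by linarith
      then show ?thesis
        using pos mult_less_cancel_left_pos by blast
    qed
  qed
  then show False
    using assms(5) f(1) unfolding peaks_within_def by blast
qed

section \<open>Identification of the Shilov boundary\<close>

definition peak_limits :: "'k set" where
  "peak_limits = {x. \<forall>U. open U \<longrightarrow> x \<in> U \<longrightarrow> peaks_within U}"

lemma closed_peak_limits: "closed peak_limits"
proof -
  have "- peak_limits = \<Union> {U. open U \<and> \<not> peaks_within U}"
    by (auto simp: peak_limits_def)
  then have "open (- peak_limits)"
    by auto
  then show ?thesis
    by (simp add: closed_def)
qed

text \<open>Otherwise some function in \<open>A\<close> would attain its norm only inside the open
  complement of \<open>L\<close>, although it must attain it on \<open>L\<close>.\<close>

lemma peak_limits_subset:
  assumes "closed L" "is_boundary A L"
  shows "peak_limits \<subseteq> L"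
proof
  fix x assume "x \<in> peak_limits"
  show "x \<in> L"
  proof (rule ccontr)
    assume "x \<notin> L"
    with \<open>x \<in> peak_limits\<close> have "peaks_within (- L)"
      using assms by (auto simp: peak_limits_def)
    then show False
      using assms(2) unfolding peaks_within_def is_boundary_def by blast
  qed
qed

text \<open>If the maximum set \<open>M\<close> of some \<open>f\<close> missed
  \<open>peak_limits\<close>, finitely many polyballs in which nothing peaks would cover the compact
  set \<open>M\<close>. Removing them one by one from the whole space leaves a boundary disjoint
  from \<open>M\<close>, which is absurd for \<open>f\<close>.\<close>

lemma is_boundary_peak_limits: "is_boundary A peak_limits"
proof (rule ccontr)
  assume "\<not> is_boundary A peak_limits"
  then obtain f where f: "f \<in> A" "\<And>t. t \<in> peak_limits \<Longrightarrow> cmod (apply_bcontfun f t) \<noteq> norm f"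
    unfolding is_boundary_def by blast
  define M where "M = {x. cmod (apply_bcontfun f x) = norm f}"
  have "\<exists>F. finite F \<and> F \<subseteq> A \<and> x \<in> polyball F \<and> \<not> peaks_within (polyball F)" if "x \<in> M" for x
  proof -
    from f(2) that have "x \<notin> peak_limits"
      by (auto simp: M_def)
    then obtain U where "open U" "x \<in> U" "\<not> peaks_within U"
      by (auto simp: peak_limits_def)
    then show ?thesis
      using polyball_neighbourhood[of U x] peaks_within_mono by metis
  qed
  then obtain F where F: "\<And>x. x \<in> M \<Longrightarrow> finite (F x)" "\<And>x. x \<in> M \<Longrightarrow> F x \<subseteq> A"
      "\<And>x. x \<in> M \<Longrightarrow> x \<in> polyball (F x)" "\<And>x. x \<in> M \<Longrightarrow> \<not> peaks_within (polyball (F x))"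
    by metis
  have "closed M"
    unfolding M_def by (intro closed_Collect_eq continuous_intros continuous_on_apply_bcontfun)
  then have "compact M"
    by (rule compact_closed)
  moreover have "open (polyball (F x))" if "x \<in> M" for x
    using F(1)[OF that] by (rule open_polyball)
  moreover have "M \<subseteq> (\<Union>x\<in>M. polyball (F x))"
    using F(3) by blast
  ultimately obtain X where X: "X \<subseteq> M" "finite X" "M \<subseteq> (\<Union>x\<in>X. polyball (F x))"
    by (rule compactE_image)
  \<comment> \<open>Closedness is carried through the induction because each removal of a polyball
    starts from a closed boundary.\<close>
  have "closed (UNIV - (\<Union>x\<in>X. polyball (F x))) \<and> is_boundary A (UNIV - (\<Union>x\<in>X. polyball (F x)))"
    using X(2,1)
  proof (induction X rule: finite_induct)
    case empty
    then show ?case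
      by (simp add: is_boundary_UNIV)
  next
    case (insert x X)
    have "UNIV - (\<Union>x\<in>insert x X. polyball (F x)) = UNIV - (\<Union>x\<in>X. polyball (F x)) - polyball (F x)"
      by auto
    then show ?case
      using insert.IH insert.prems F[of x]
      by (metis closed_Diff open_polyball is_boundary_diff_polyball insert_subset)
  qed
  then show False
    using f(1) X(3) unfolding is_boundary_def M_def by blast
qed

text \<open>Inclusion is not a total order, so \<open>LEAST\<close> has a meaning only once a
  smallest closed boundary is exhibited.\<close>

theorem shilov_boundary_eq: "shilov_boundary A = peak_limits"
  unfolding shilov_boundary_def
  by (rule Least_equality) (auto simp: closed_peak_limits is_boundary_peak_limits peak_limits_subset)

section \<open>Peak functions and indicators at an isolated boundary point\<close>

lemma norm_le_shilov:
  assumes "g \<in> A" "\<And>t. t \<in> shilov_boundary A \<Longrightarrow> cmod (apply_bcontfun g t) \<le> c"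
  shows "norm g \<le> c"
  using assms is_boundary_peak_limits unfolding is_boundary_def shilov_boundary_eq by metis

lemma peak_function_at_isolated:
  assumes "t0 isolated_in shilov_boundary A" "s \<noteq> t0"
  obtains f r where "f \<in> A" "apply_bcontfun f t0 = 1" "0 \<le> r" "r < 1"
    "\<And>t. t \<in> shilov_boundary A - {t0} \<Longrightarrow> cmod (apply_bcontfun f t) \<le> r"
proof -
  obtain U where U: "open U" "U \<inter> shilov_boundary A = {t0}"
    using assms by (auto simp: isolated_in_def)
  \<comment> \<open>Removing \<open>s\<close> makes sure that the function peaking within the neighbourhood is not zero.\<close>
  define V where "V = U - {s}"
  have V: "open V" "V \<inter> shilov_boundary A = {t0}"
    using U \<open>s \<noteq> t0\<close> by (auto simp: V_def)
  then have "peaks_within V"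
    by (auto simp: shilov_boundary_eq peak_limits_def)
  then obtain f where f: "f \<in> A" "\<And>x. cmod (apply_bcontfun f x) = norm f \<Longrightarrow> x \<in> V"
    by (auto simp: peaks_within_def)
  have "norm f \<noteq> 0"
    using f(2)[of s] by (auto simp: V_def)
  obtain t where t: "t \<in> shilov_boundary A" "cmod (apply_bcontfun f t) = norm f"
    using f(1) is_boundary_peak_limits unfolding is_boundary_def shilov_boundary_eq by blast
  then have "t = t0"
    using f(2) V(2) by blast
  with t have ft0: "cmod (apply_bcontfun f t0) = norm f"
    by simp
  \<comment> \<open>This set is the boundary without \<open>t0\<close>; as a closed set on which
    \<open>f\<close> stays off its norm, it yields a uniform ratio \<open>r\<close>.\<close>
  have "closed (shilov_boundary A - V)"
    using V closed_peak_limits by (auto simp: shilov_boundary_eq)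
  then obtain r where r: "0 \<le> r" "r < 1"
      "\<And>t. t \<in> shilov_boundary A - V \<Longrightarrow> cmod (apply_bcontfun f t) \<le> r * norm f"
    by (rule bounded_away_from_norm[of _ f]) (use f(2) in auto)
  show ?thesis
  proof
    show "bc_scale (inverse (apply_bcontfun f t0)) f \<in> A"
      using f by (simp add: scale_mem)
    have "apply_bcontfun f t0 \<noteq> 0"
      using ft0 \<open>norm f \<noteq> 0\<close> norm_eq_zero by metis
    then show "apply_bcontfun (bc_scale (inverse (apply_bcontfun f t0)) f) t0 = 1"
      by simp
    show "cmod (apply_bcontfun (bc_scale (inverse (apply_bcontfun f t0)) f) t) \<le> r"
      if "t \<in> shilov_boundary A - {t0}" for t
    proof -
      from that V(2) have "t \<in> shilov_boundary A - V"
        by auto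
      with r(3) have "cmod (apply_bcontfun f t) \<le> r * norm f"
        by blast
      then show ?thesis
        using ft0 \<open>norm f \<noteq> 0\<close> by (simp add: norm_mult norm_inverse norm_divide field_simps)
    qed
  qed (use r in auto)
qed

lemma indicator_at_isolated:
  assumes "t0 isolated_in shilov_boundary A" "s \<noteq> t0"
  obtains h where "h \<in> A" "apply_bcontfun h t0 = 1"
    "\<And>t. t \<in> shilov_boundary A - {t0} \<Longrightarrow> apply_bcontfun h t = 0"
proof -
  obtain f r where f: "f \<in> A" "apply_bcontfun f t0 = 1" and r: "0 \<le> r" "r < 1"
    "\<And>t. t \<in> shilov_boundary A - {t0} \<Longrightarrow> cmod (apply_bcontfun f t) \<le> r"
    using assms by (rule peak_function_at_isolated) blast
  have "Cauchy (bc_power f)"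
  proof (rule CauchyI)
    fix e :: real assume "0 < e"
    then obtain N where N: "r ^ N < e / 2"
      using real_arch_pow_inv[of "e / 2" r] r by auto
    have "norm (bc_power f m - bc_power f n) < e" if "N \<le> m" "N \<le> n" for m n
    proof -
      \<comment> \<open>It suffices to estimate on the boundary: at \<open>t0\<close> all powers
        equal 1, and elsewhere both powers are at most \<open>r ^ N\<close> in modulus.\<close>
      have "norm (bc_power f m - bc_power f n) \<le> 2 * r ^ N"
      proof (rule norm_le_shilov)
        show "bc_power f m - bc_power f n \<in> A"
          using f by (intro diff_mem power_mem)
        fix t assume t: "t \<in> shilov_boundary A"
        show "cmod (apply_bcontfun (bc_power f m - bc_power f n) t) \<le> 2 * r ^ N"
        proof (cases "t = t0")
          case True
          then show ?thesis
            using f r by (simp add: minus_bcontfun.rep_eq)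
        next
          case False
          have le: "cmod (apply_bcontfun f t) ^ k \<le> r ^ N" if "N \<le> k" for k
          proof -
            have "cmod (apply_bcontfun f t) ^ k \<le> r ^ k"
              using r t False by (intro power_mono) auto
            also have "\<dots> \<le> r ^ N"
              using r that by (intro power_decreasing) auto
            finally show ?thesis .
          qed
          have "cmod (apply_bcontfun f t ^ m - apply_bcontfun f t ^ n)
              \<le> cmod (apply_bcontfun f t) ^ m + cmod (apply_bcontfun f t) ^ n"
            by (metis norm_power norm_triangle_ineq4)
          then show ?thesis
            using le[OF \<open>N \<le> m\<close>] le[OF \<open>N \<le> n\<close>] by (simp add: minus_bcontfun.rep_eq)
        qed
      qed
      with N show ?thesis
        by linarith
    qed
    then show "\<exists>N. \<forall>m\<ge>N. \<forall>n\<ge>N. norm (bc_power f m - bc_power f n) < e"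
      by blast
  qed
  then obtain h where h: "bc_power f \<longlonglongrightarrow> h"
    by (rule Cauchy_bcontfun_convergent)
  \<comment> \<open>Pointwise limits identify \<open>h\<close> on the boundary: 1 at
    \<open>t0\<close>, and 0 where the modulus of \<open>f\<close> is below 1.\<close>
  have lim: "(\<lambda>n. apply_bcontfun f t ^ n) \<longlonglongrightarrow> apply_bcontfun h t" for t
  proof (rule metric_tendsto_imp_tendsto[OF h], rule always_eventually, rule allI)
    show "dist (apply_bcontfun f t ^ n) (apply_bcontfun h t) \<le> dist (bc_power f n) h" for n
      using dist_bounded[of "bc_power f n" t h] by simp
  qed
  show ?thesis
  proof
    show "h \<in> A"
      using closed_A h power_mem[OF f(1)] by (auto intro: closed_sequentially)
    show "apply_bcontfun h t0 = 1"
      using lim[of t0] f(2) by (simp add: LIMSEQ_const_iff)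
    show "apply_bcontfun h t = 0" if "t \<in> shilov_boundary A - {t0}" for t
    proof -
      have "cmod (apply_bcontfun f t) < 1"
        using r(2) r(3)[OF that] by linarith
      then show ?thesis
        using LIMSEQ_unique[OF lim LIMSEQ_power_zero] by blast
    qed
  qed
qed

end

section \<open>The rank-one projection given by evaluation at the isolated point\<close>

theorem proposition4p9:
  fixes A :: "('k::t2_space \<Rightarrow>\<^sub>C complex) set" and t0 :: 'k
  assumes "compact (UNIV :: 'k set)"
    and "\<exists>s t :: 'k. s \<noteq> t"
    and "uniform_algebra A"
    and "t0 isolated_in shilov_boundary A"
  shows "\<exists>P. projection_on A P \<and> onorm_on A P = 1 \<and> onorm_on A (\<lambda>f. f - P f) = 1"
proof -
  interpret compact_uniform_algebra A
    using assms by unfold_locales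
  from assms(2) obtain s where s: "s \<noteq> t0"
    by metis
  obtain h where h: "h \<in> A" "apply_bcontfun h t0 = 1"
    "\<And>t. t \<in> shilov_boundary A - {t0} \<Longrightarrow> apply_bcontfun h t = 0"
    using assms(4) s by (rule indicator_at_isolated) blast
  \<comment> \<open>The value 1 of \<open>h\<close> at \<open>t0\<close> makes \<open>P\<close>
    idempotent and fixes \<open>h\<close>.\<close>
  define P where "P = (\<lambda>f. bc_scale (apply_bcontfun f t0) h)"
  have "norm h \<le> 1"
  proof (rule norm_le_shilov[OF h(1)])
    show "cmod (apply_bcontfun h t) \<le> 1" if "t \<in> shilov_boundary A" for t
      using h that by (cases "t = t0") auto
  qed
  then have norm_P: "norm (P f) \<le> norm f" for f
    unfolding P_def norm_bc_scale using norm_bounded[of f t0]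
    by (metis mult_mono norm_ge_zero mult.right_neutral)
  have P_mem: "P f \<in> A" for f
    using h by (simp add: P_def scale_mem)
  have "projection_on A P"
    unfolding projection_on_def bounded_operator_on_def
  proof (intro conjI ballI allI exI)
    show "norm (P f) \<le> 1 * norm f" for f
      using norm_P by simp
  qed (auto simp: P_mem, auto simp: P_def h plus_bcontfun.rep_eq algebra_simps intro!: bcontfun_eqI)
  moreover have "onorm_on A P = 1"
  proof (rule onorm_on_eq_1[OF norm_P h(1)])
    show "h \<noteq> 0"
      using h(2) by auto
    show "P h = h"
      by (rule bcontfun_eqI) (simp add: P_def h)
  qed
  moreover have "onorm_on A (\<lambda>f. f - P f) = 1"
  proof -
    obtain g where g: "g \<in> A" "apply_bcontfun g s \<noteq> apply_bcontfun g t0"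
      using separates[OF s] by blast
    \<comment> \<open>A nonzero element of the kernel of \<open>P\<close>, hence fixed by the
      complementary projection; it exists because there is a second point \<open>s\<close>.\<close>
    define k where "k = g - const_bcontfun (apply_bcontfun g t0)"
    have k: "k \<in> A" "apply_bcontfun k t0 = 0" "apply_bcontfun k s \<noteq> 0"
      using g by (auto simp: k_def diff_mem const_mem minus_bcontfun.rep_eq const_bcontfun.rep_eq)
    \<comment> \<open>On the boundary \<open>f - P f\<close> is 0 at \<open>t0\<close> and agrees
      with \<open>f\<close> elsewhere.\<close>
    have "norm (f - P f) \<le> norm f" if "f \<in> A" for f
    proof (rule norm_le_shilov)
      show "f - P f \<in> A"
        using that P_mem by (rule diff_mem)
      show "cmod (apply_bcontfun (f - P f) t) \<le> norm f" if "t \<in> shilov_boundary A" for t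
        using h that norm_bounded[of f t] by (cases "t = t0") (auto simp: P_def minus_bcontfun.rep_eq)
    qed
    then show ?thesis
    proof (rule onorm_on_eq_1[OF _ k(1)])
      show "k \<noteq> 0"
        using k(3) by auto
      show "k - P k = k"
        using k(2) by (intro bcontfun_eqI) (simp add: P_def minus_bcontfun.rep_eq)
    qed
  qed
  ultimately show ?thesis
    by blast
qed

end
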